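(* Let $A$ be a $\mathbb{K}$-vector space with a linear map $\alpha:A\to A$, a commutative Hom-associative multiplication $\cdot$ (i.e. $(A,\cdot,\alpha)$ is a commutative Hom-associative algebra) and a Hom-Lie bracket $\{\cdot,\cdot\}$ (i.e. $(A,\{\cdot,\cdot\},\alpha)$ is a Hom-Lie algebra). (i) If either $\cdot$ or $\{\cdot,\cdot\}$ is zero, then $(A,\cdot,\{\cdot,\cdot\},\alpha)$ is a transposed Hom-Poisson algebra, as well as a Hom-Poisson algebra. (ii) $(A,\cdot,\{\cdot,\cdot\},\alpha)$ is both a Hom-Poisson algebra and a transposed Hom-Poisson algebra if and only if $\alpha(x)\cdot\{y,z\}=\{x\cdot y,\alpha(z)\}=0$ for all $x,y,z\in A$.
   Context: $\mathbb{K}$ is an algebraically closed field of characteristic $0$. A commutative Hom-associative algebra $(A,\cdot,\alpha)$ is a vector space $A$ with a bilinear product $\cdot$ and a linear map $\alpha:A\to A$ with $x\cdot y=y\cdot x$ and $\alpha(x)\cdot(y\cdot z)=(x\cdot y)\cdot\alpha(z)$. A Hom-Lie algebra $(A,\{\cdot,\cdot\},\alpha)$ is a vector space with a skew-symmetric bilinear bracket and a linear map $\alpha$ with $\{\alpha(x),\{y,z\}\}+\{\alpha(y),\{z,x\}\}+\{\alpha(z),\{x,y\}\}=0$. $(A,\cdot,\{\cdot,\cdot\},\alpha)$, where $(A,\cdot,\alpha)$ is a commutative Hom-associative algebra and $(A,\{\cdot,\cdot\},\alpha)$ is a Hom-Lie algebra, is a Hom-Poisson algebra if $\{\alpha(x),y\cdot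 z\}=\alpha(y)\cdot\{x,z\}+\alpha(z)\cdot\{x,y\}$ for all $x,y,z$, and a transposed Hom-Poisson algebra if $2\alpha(z)\cdot\{x,y\}=\{z\cdot x,\alpha(y)\}+\{\alpha(x),z\cdot y\}$ for all $x,y,z$. *)

theory Defs
  imports "HOL-Computational_Algebra.Polynomial"
begin

text \<open>
  A vector space is given by a scalar multiplication on a whole type, as in
  the library locale \<^locale>\<open>vector_space\<close>. The locales below make sense over any field.
  Bilinearity is linearity in each argument separately; linearity over the given scalar
  multiplication is the qualified \<^const>\<open>Vector_Spaces.linear\<close>.
\<close>

locale bilinear_product = vector_space scale
  for scale :: "'k::field \<Rightarrow> 'a::ab_group_add \<Rightarrow> 'a" +
  fixes f :: "'a \<Rightarrow> 'a \<Rightarrow> 'a"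
  assumes linear_left: "Vector_Spaces.linear scale scale (\<lambda>x. f x y)"
    and linear_right: "Vector_Spaces.linear scale scale (\<lambda>y. f x y)"

locale comm_hom_assoc_algebra = bilinear_product scale mult
  for scale :: "'k::field \<Rightarrow> 'a::ab_group_add \<Rightarrow> 'a"
    and mult :: "'a \<Rightarrow> 'a \<Rightarrow> 'a" (infixl \<open>\<cdot>\<close> 70) +
  fixes \<alpha> :: "'a \<Rightarrow> 'a"
  assumes linear_twist: "Vector_Spaces.linear scale scale \<alpha>"
    and commute: "x \<cdot> y = y \<cdot> x"
    and hom_assoc: "\<alpha> x \<cdot> (y \<cdot> z) = (x \<cdot> y) \<cdot> \<alpha> z"

locale hom_lie_algebra = bilinear_product scale bracket
  for scale :: "'k::field \<Rightarrow> 'a::ab_group_add \<Rightarrow> 'a"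
    and bracket :: "'a \<Rightarrow> 'a \<Rightarrow> 'a" (\<open>\<lbrace>_,/ _\<rbrace>\<close>) +
  fixes \<alpha> :: "'a \<Rightarrow> 'a"
  assumes linear_twist: "Vector_Spaces.linear scale scale \<alpha>"
    and skew: "\<lbrace>x, y\<rbrace> = - \<lbrace>y, x\<rbrace>"
    and hom_jacobi: "\<lbrace>\<alpha> x, \<lbrace>y, z\<rbrace>\<rbrace> + \<lbrace>\<alpha> y, \<lbrace>z, x\<rbrace>\<rbrace> + \<lbrace>\<alpha> z, \<lbrace>x, y\<rbrace>\<rbrace> = 0"

locale hom_poisson_algebra =
  assoc: comm_hom_assoc_algebra scale mult \<alpha> + lie: hom_lie_algebra scale bracket \<alpha>
  for scale :: "'k::field \<Rightarrow> 'a::ab_group_add \<Rightarrow> 'a"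
    and mult :: "'a \<Rightarrow> 'a \<Rightarrow> 'a" (infixl \<open>\<cdot>\<close> 70)
    and bracket :: "'a \<Rightarrow> 'a \<Rightarrow> 'a" (\<open>\<lbrace>_,/ _\<rbrace>\<close>)
    and \<alpha> :: "'a \<Rightarrow> 'a" +
  assumes hom_leibniz: "\<lbrace>\<alpha> x, y \<cdot> z\<rbrace> = \<alpha> y \<cdot> \<lbrace>x, z\<rbrace> + \<alpha> z \<cdot> \<lbrace>x, y\<rbrace>"

locale transposed_hom_poisson_algebra =
  assoc: comm_hom_assoc_algebra scale mult \<alpha> + lie: hom_lie_algebra scale bracket \<alpha>
  for scale :: "'k::field \<Rightarrow> 'a::ab_group_add \<Rightarrow> 'a"
    and mult :: "'a \<Rightarrow> 'a \<Rightarrow> 'a" (infixl \<open>\<cdot>\<close> 70)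
    and bracket :: "'a \<Rightarrow> 'a \<Rightarrow> 'a" (\<open>\<lbrace>_,/ _\<rbrace>\<close>)
    and \<alpha> :: "'a \<Rightarrow> 'a" +
  assumes transposed_hom_leibniz:
    "scale 2 (\<alpha> z \<cdot> \<lbrace>x, y\<rbrace>) = \<lbrace>z \<cdot> x, \<alpha> y\<rbrace> + \<lbrace>\<alpha> x, z \<cdot> y\<rbrace>"

end

theory Submission
  imports Defs
begin

text \<open>
  Write \<open>p x y z = \<alpha> x \<cdot> \<lbrace>y, z\<rbrace>\<close>, which is skew-symmetric in \<open>y\<close> and \<open>z\<close>. The Hom-Leibniz rule
  expresses both brackets on the right of the transposed rule through \<open>p\<close>. After this
  substitution the two copies of \<open>p z x y\<close> cancel against the left-hand side, and what remains is
  the symmetry \<open>p x y z = p y x z\<close>. A function of three arguments that is symmetric in the first two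
  and skew-symmetric in the last two equals its own negative, because transporting the sign
  along a braid relation in the symmetric group on three letters gives both signs
  (\<open>eq_uminus_if_symmetric_skew\<close>). Since 2 is invertible, \<open>p = 0\<close>, and the Hom-Leibniz
  rule then also annihilates \<open>\<lbrace>x \<cdot> y, \<alpha> z\<rbrace>\<close>. Conversely, once all these mixed products vanish, every
  term of either compatibility rule is zero. Part (i) is an instance of this converse, as
  mixed products vanish when one of the two operations is zero.
\<close>

text \<open>
  The transpositions \<open>s = (1 2)\<close> and \<open>t = (2 3)\<close> satisfy \<open>s t s = t s t\<close>. With \<open>s\<close> acting by \<open>+1\<close> and
  \<open>t\<close> by \<open>-1\<close>, the left word contributes the sign \<open>-1\<close> and the right word the sign \<open>+1\<close>.
\<close>
lemma eq_uminus_if_symmetric_skew: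
  fixes p :: "'b \<Rightarrow> 'b \<Rightarrow> 'b \<Rightarrow> 'a::ab_group_add"
  assumes sym: "\<And>x y z. p x y z = p y x z"
    and skew: "\<And>x y z. p x y z = - p x z y"
  shows "p x y z = - p x y z"
proof -
  have "p x y z = - p z y x"
    using sym[of x y z] skew[of y x z] sym[of y z x] by simp
  moreover have "p x y z = p z y x"
    using skew[of x y z] sym[of x z y] skew[of z x y] by simp
  ultimately show ?thesis by simp
qed

context vector_space
begin

lemma eq_uminus_iff_zero:
  assumes "(2::'a) \<noteq> 0"
  shows "(v::'b) = - v \<longleftrightarrow> v = 0"
proof
  assume "v = - v"
  then have "scale 2 v = 0"
    using scale_left_distrib[of 1 1 v] by (metis add.right_inverse one_add_one scale_one)
  with assms show "v = 0" by simp
qed simp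

end

context bilinear_product
begin

lemma zero_left: "f 0 y = 0"
  using module_hom.zero[OF linear_left[of y, unfolded linear_iff_module_hom]] .

lemma zero_right: "f x 0 = 0"
  using module_hom.zero[OF linear_right[of x, unfolded linear_iff_module_hom]] .

end

locale hom_assoc_lie_pair =
  assoc: comm_hom_assoc_algebra scale mult \<alpha> + lie: hom_lie_algebra scale bracket \<alpha>
  for scale :: "'k::field \<Rightarrow> 'a::ab_group_add \<Rightarrow> 'a"
    and mult :: "'a \<Rightarrow> 'a \<Rightarrow> 'a" (infixl \<open>\<cdot>\<close> 70)
    and bracket :: "'a \<Rightarrow> 'a \<Rightarrow> 'a" (\<open>\<lbrace>_,/ _\<rbrace>\<close>)
    and \<alpha> :: "'a \<Rightarrow> 'a"
begin

lemma mult_bracket_skew: "\<alpha> x \<cdot> \<lbrace>y, z\<rbrace> = - (\<alpha> x \<cdot> \<lbrace>z, y\<rbrace>)"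
proof -
  have "\<alpha> x \<cdot> \<lbrace>y, z\<rbrace> = \<alpha> x \<cdot> (- \<lbrace>z, y\<rbrace>)"
    using lie.skew[of y z] by simp
  then show ?thesis
    using module_hom.neg[OF assoc.linear_right[of "\<alpha> x", unfolded linear_iff_module_hom]]
    by simp
qed

text \<open>
  Expanding both brackets of the transposed rule by the Hom-Leibniz rule leaves
  \<open>2 p z x y = 2 p z x y - p x y z + p y x z\<close>.
\<close>
lemma mult_bracket_swap:
  assumes "hom_poisson_algebra scale mult bracket \<alpha>"
    and "transposed_hom_poisson_algebra scale mult bracket \<alpha>"
  shows "\<alpha> x \<cdot> \<lbrace>y, z\<rbrace> = \<alpha> y \<cdot> \<lbrace>x, z\<rbrace>"
proof -
  interpret P: hom_poisson_algebra scale mult bracket \<alpha> by fact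
  interpret T: transposed_hom_poisson_algebra scale mult bracket \<alpha> by fact
  have "\<alpha> z \<cdot> \<lbrace>x, y\<rbrace> + \<alpha> z \<cdot> \<lbrace>x, y\<rbrace> = scale 2 (\<alpha> z \<cdot> \<lbrace>x, y\<rbrace>)"
    using assoc.scale_left_distrib[of 1 1] by simp
  also have "\<dots> = - \<lbrace>\<alpha> y, z \<cdot> x\<rbrace> + \<lbrace>\<alpha> x, z \<cdot> y\<rbrace>"
    using T.transposed_hom_leibniz[of z x y] lie.skew[of "z \<cdot> x" "\<alpha> y"] by simp
  also have "\<dots> = \<alpha> z \<cdot> \<lbrace>x, y\<rbrace> - \<alpha> x \<cdot> \<lbrace>y, z\<rbrace> + (\<alpha> z \<cdot> \<lbrace>x, y\<rbrace> + \<alpha> y \<cdot> \<lbrace>x, z\<rbrace>)"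
    using mult_bracket_skew[of z y x] by (simp add: P.hom_leibniz)
  finally show ?thesis by (simp add: algebra_simps)
qed

lemma mixed_products_vanish:
  assumes "(2::'k) \<noteq> 0"
    and poisson: "hom_poisson_algebra scale mult bracket \<alpha>"
    and transposed: "transposed_hom_poisson_algebra scale mult bracket \<alpha>"
  shows "\<alpha> x \<cdot> \<lbrace>y, z\<rbrace> = 0" and "\<lbrace>x \<cdot> y, \<alpha> z\<rbrace> = 0"
proof -
  have mult_bracket: "\<alpha> x \<cdot> \<lbrace>y, z\<rbrace> = 0" for x y z
    using eq_uminus_if_symmetric_skew[of "\<lambda>x y z. \<alpha> x \<cdot> \<lbrace>y, z\<rbrace>",
        OF mult_bracket_swap[OF poisson transposed] mult_bracket_skew]
      assoc.eq_uminus_iff_zero[OF assms(1)] by blast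
  then show "\<alpha> x \<cdot> \<lbrace>y, z\<rbrace> = 0" .
  show "\<lbrace>x \<cdot> y, \<alpha> z\<rbrace> = 0"
    using hom_poisson_algebra.hom_leibniz[OF poisson, of z x y] lie.skew[of "x \<cdot> y" "\<alpha> z"]
    by (simp add: mult_bracket)
qed

lemma both_hom_poisson_if_mixed_products_vanish:
  assumes mult_bracket: "\<And>x y z. \<alpha> x \<cdot> \<lbrace>y, z\<rbrace> = 0"
    and bracket_mult: "\<And>x y z. \<lbrace>x \<cdot> y, \<alpha> z\<rbrace> = 0"
  shows "hom_poisson_algebra scale mult bracket \<alpha>"
    and "transposed_hom_poisson_algebra scale mult bracket \<alpha>"
proof -
  have "\<lbrace>\<alpha> x, y \<cdot> z\<rbrace> = 0" for x y z
    using bracket_mult[of y z x] lie.skew[of "\<alpha> x" "y \<cdot> z"] by simp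
  then show "hom_poisson_algebra scale mult bracket \<alpha>"
    and "transposed_hom_poisson_algebra scale mult bracket \<alpha>"
    by (unfold_locales; simp add: mult_bracket bracket_mult)+
qed

lemma mixed_products_vanish_if_operation_zero:
  assumes "(\<forall>x y. x \<cdot> y = 0) \<or> (\<forall>x y. \<lbrace>x, y\<rbrace> = 0)"
  shows "\<alpha> x \<cdot> \<lbrace>y, z\<rbrace> = 0" and "\<lbrace>x \<cdot> y, \<alpha> z\<rbrace> = 0"
  using assms by (auto simp: assoc.zero_right lie.zero_left)

end

theorem proposition2p31:
  fixes scale :: "'k::{alg_closed_field, field_char_0} \<Rightarrow> 'a::ab_group_add \<Rightarrow> 'a"
    and mult :: "'a \<Rightarrow> 'a \<Rightarrow> 'a" (infixl \<open>\<cdot>\<close> 70)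
    and bracket :: "'a \<Rightarrow> 'a \<Rightarrow> 'a" (\<open>\<lbrace>_,/ _\<rbrace>\<close>)
    and \<alpha> :: "'a \<Rightarrow> 'a"
  assumes "comm_hom_assoc_algebra scale mult \<alpha>"
    and "hom_lie_algebra scale bracket \<alpha>"
  shows "((\<forall>x y. x \<cdot> y = 0) \<or> (\<forall>x y. \<lbrace>x, y\<rbrace> = 0) \<longrightarrow>
            transposed_hom_poisson_algebra scale mult bracket \<alpha> \<and>
            hom_poisson_algebra scale mult bracket \<alpha>)
       \<and> (hom_poisson_algebra scale mult bracket \<alpha> \<and>
            transposed_hom_poisson_algebra scale mult bracket \<alpha> \<longleftrightarrow>
          (\<forall>x y z. \<alpha> x \<cdot> \<lbrace>y, z\<rbrace> = 0 \<and> \<lbrace>x \<cdot> y, \<alpha> z\<rbrace> = 0))"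
proof -
  interpret hom_assoc_lie_pair scale mult bracket \<alpha>
    using assms by (rule hom_assoc_lie_pair.intro)
  have two: "(2::'k) \<noteq> 0" by simp
  show ?thesis
    using mixed_products_vanish[OF two] both_hom_poisson_if_mixed_products_vanish
      mixed_products_vanish_if_operation_zero by blast
qed

end
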